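(* Let $\psi:[0,\infty)\to\mathbb{R}$ be a $C^1$ function with $\psi'>0$, $\psi(0)=0$ and $\psi(x)\to\infty$ as $x\to\infty$, and let $\omega\in L^\infty(\mathbb{R}^+)$ be a nowhere zero weight function. Let $\alpha,p\in\mathbb{C}$ with $\Re(\alpha)>0$ and $\Re(p)<1-\Re(\alpha)$, and let $f:\mathbb{R}^+\to\mathbb{C}$ be such that the function $x\mapsto\psi(x)^{p+\alpha-1}f(x)$ belongs to $L^1_{\omega,\psi}(\mathbb{R}^+)$. Then $$\mathcal{M}_{\psi,\omega}\big[{}^{RL}_{\ 0}I^{\alpha}_{\psi,\omega}f\big](p)=\frac{\Gamma(1-p-\alpha)}{\Gamma(1-p)}\,\mathcal{M}_{\psi,\omega}[f](p+\alpha).$$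
   Context: Here $\mathbb{R}^+=(0,\infty)$. The space $L^1_{\omega,\psi}(\mathbb{R}^+)$ consists of the measurable functions $f:\mathbb{R}^+\to\mathbb{C}$ with $\int_0^\infty|\omega(x)f(x)|\,\psi'(x)\,dx<\infty$. The generalized ($\psi$-$\omega$-) Mellin transform is $$\mathcal{M}_{\psi,\omega}[f](p)=\int_0^\infty(\psi(x))^{p-1}\omega(x)f(x)\psi'(x)\,dx,$$ for those $p\in\mathbb{C}$ for which the integral converges. The $\omega$-weighted Riemann-Liouville fractional integral with respect to $\psi$ of order $\alpha$, $\Re(\alpha)>0$, is $${}^{RL}_{\ 0}I^{\alpha}_{\psi,\omega}f(x)=\frac{1}{\Gamma(\alpha)\,\omega(x)}\int_0^x(\psi(x)-\psi(t))^{\alpha-1}\omega(t)f(t)\psi'(t)\,dt,\qquad x>0,$$ for those (almost every) $x$ for which the integral converges. *)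

theory Defs
  imports "HOL-Analysis.Analysis"
begin

text \<open>
  Functions on \<open>(0,\<infinity>)\<close> or \<open>[0,\<infinity>)\<close> are total functions on \<open>real\<close> of which only the values on
  the respective domain are used. All integrals are Lebesgue integrals, so convergence of an
  integral means integrability; the library integral of a non-integrable function is 0, hence
  the explicit convergence predicates below.
\<close>

text \<open>
  The derivative of a function on \<open>[0,\<infinity>)\<close>: one-sided at 0, the ordinary one elsewhere.
\<close>

definition hderiv :: "(real \<Rightarrow> real) \<Rightarrow> real \<Rightarrow> real" where
  "hderiv \<psi> x = vector_derivative \<psi> (at x within {0..})"

definition C1_halfline :: "(real \<Rightarrow> real) \<Rightarrow> bool" where
  "C1_halfline \<psi> \<longleftrightarrow> \<psi> differentiable_on {0..} \<and> continuous_on {0..} (hderiv \<psi>)"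

definition Linfty_pos :: "(real \<Rightarrow> complex) set" where
  "Linfty_pos = {\<omega>. \<omega> \<in> borel_measurable (lebesgue_on {0<..}) \<and>
     (\<exists>C. AE x in lebesgue_on {0<..}. norm (\<omega> x) \<le> C)}"

definition L1_weighted :: "(real \<Rightarrow> complex) \<Rightarrow> (real \<Rightarrow> real) \<Rightarrow> (real \<Rightarrow> complex) set" where
  "L1_weighted \<omega> \<psi> = {f. f \<in> borel_measurable (lebesgue_on {0<..}) \<and>
     (\<integral>\<^sup>+x\<in>{0<..}. ennreal (norm (\<omega> x * f x) * hderiv \<psi> x) \<partial>lebesgue) < \<infinity>}"

definition mellin_integrand ::
  "(real \<Rightarrow> real) \<Rightarrow> (real \<Rightarrow> complex) \<Rightarrow> (real \<Rightarrow> complex) \<Rightarrow> complex \<Rightarrow> real \<Rightarrow> complex" where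
  "mellin_integrand \<psi> \<omega> f p x =
     of_real (\<psi> x) powr (p - 1) * \<omega> x * f x * of_real (hderiv \<psi> x)"

definition mellin_converges ::
  "(real \<Rightarrow> real) \<Rightarrow> (real \<Rightarrow> complex) \<Rightarrow> (real \<Rightarrow> complex) \<Rightarrow> complex \<Rightarrow> bool" where
  "mellin_converges \<psi> \<omega> f p \<longleftrightarrow> set_integrable lebesgue {0<..} (mellin_integrand \<psi> \<omega> f p)"

definition mellin ::
  "(real \<Rightarrow> real) \<Rightarrow> (real \<Rightarrow> complex) \<Rightarrow> (real \<Rightarrow> complex) \<Rightarrow> complex \<Rightarrow> complex" where
  "mellin \<psi> \<omega> f p = (LINT x:{0<..}|lebesgue. mellin_integrand \<psi> \<omega> f p x)"

definition RL_integrand ::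
  "(real \<Rightarrow> real) \<Rightarrow> (real \<Rightarrow> complex) \<Rightarrow> complex \<Rightarrow> (real \<Rightarrow> complex) \<Rightarrow> real \<Rightarrow> real \<Rightarrow> complex" where
  "RL_integrand \<psi> \<omega> \<alpha> f x t =
     of_real (\<psi> x - \<psi> t) powr (\<alpha> - 1) * \<omega> t * f t * of_real (hderiv \<psi> t)"

definition RL_converges ::
  "(real \<Rightarrow> real) \<Rightarrow> (real \<Rightarrow> complex) \<Rightarrow> complex \<Rightarrow> (real \<Rightarrow> complex) \<Rightarrow> real \<Rightarrow> bool" where
  "RL_converges \<psi> \<omega> \<alpha> f x \<longleftrightarrow> set_integrable lebesgue {0<..<x} (RL_integrand \<psi> \<omega> \<alpha> f x)"

definition RL_integral ::
  "(real \<Rightarrow> real) \<Rightarrow> (real \<Rightarrow> complex) \<Rightarrow> complex \<Rightarrow> (real \<Rightarrow> complex) \<Rightarrow> real \<Rightarrow> complex" where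
  "RL_integral \<psi> \<omega> \<alpha> f x =
     1 / (Gamma \<alpha> * \<omega> x) * (LINT t:{0<..<x}|lebesgue. RL_integrand \<psi> \<omega> \<alpha> f x t)"

end

(* The Mellin transform of the fractional integral is an iterated integral of the kernel
   psi(x)^(p-1) (psi(x) - psi(t))^(alpha-1) psi'(x) over 0 < t < x against omega f psi' dt.
   Interchanging the order, the inner integral becomes, with u = psi(x) and s = psi(t),
     int_s^oo u^(p-1) (u-s)^(alpha-1) du
       = Gamma(alpha) Gamma(1-p-alpha) / Gamma(1-p) * s^(p+alpha-1),
   and Gamma(alpha) cancels. This integral is itself obtained from Fubini, by writing
   Gamma(1-p) u^(p-1) as int_0^oo y^(-p) exp(-uy) dy. Absolute convergence in both places
   is the same computation with the exponents replaced by their real parts. *)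

theory Submission
  imports Defs
begin

section \<open>Fubini, complex powers of real bases, and the passage between \<open>lborel\<close>
  and \<open>lebesgue\<close>\<close>

text \<open>Fubini with the inner integrals supplied as closed forms: \<open>n\<close> settles joint
  integrability, then \<open>i\<close> gives the value. The first conclusion later yields
  convergence of almost every fractional integral, the second their Mellin integral.\<close>

lemma has_bochner_integral_swap:
  fixes F :: "real \<Rightarrow> real \<Rightarrow> complex"
  assumes meas: "(\<lambda>(t, x). F t x) \<in> borel_measurable (borel \<Otimes>\<^sub>M borel)"
    and norm_inner: "\<And>t. has_bochner_integral lborel (\<lambda>x. norm (F t x)) (n t)"
    and norm_outer: "integrable lborel n"
    and inner: "\<And>t. has_bochner_integral lborel (F t) (i t)"
    and outer: "has_bochner_integral lborel i v"
  shows "AE x in lborel. integrable lborel (\<lambda>t. F t x)"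
    and "has_bochner_integral lborel (\<lambda>x. \<integral>t. F t x \<partial>lborel) v"
proof -
  have inner_eq: "(\<integral>x. norm (F t x) \<partial>lborel) = n t" "(\<integral>x. F t x \<partial>lborel) = i t" for t
    using norm_inner inner by (simp_all add: has_bochner_integral_iff)
  have int: "integrable (lborel \<Otimes>\<^sub>M lborel) (\<lambda>(t, x). F t x)"
  proof (rule lborel_pair.Fubini_integrable)
    show "(\<lambda>(t, x). F t x) \<in> borel_measurable (lborel \<Otimes>\<^sub>M lborel)"
      using meas by (simp add: measurable_cong_sets[OF sets_pair_measure_cong[OF sets_lborel sets_lborel] refl])
    show "integrable lborel (\<lambda>t. \<integral>x. norm (case (t, x) of (t, x) \<Rightarrow> F t x) \<partial>lborel)"
      using norm_outer by (simp add: inner_eq)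
    show "AE t in lborel. integrable lborel (\<lambda>x. case (t, x) of (t, x) \<Rightarrow> F t x)"
      using inner by (simp add: has_bochner_integral_iff)
  qed
  show "AE x in lborel. integrable lborel (\<lambda>t. F t x)"
    by (rule lborel_pair.AE_integrable_snd[OF int])
  show "has_bochner_integral lborel (\<lambda>x. \<integral>t. F t x \<partial>lborel) v"
    using lborel_pair.integrable_snd[OF int] lborel_pair.Fubini_integral[OF int] outer
    by (simp add: has_bochner_integral_iff inner_eq)
qed

text \<open>Continuity fails at the branch cut, yet differences such as u - s do become negative
  where an indicator vanishes. On real bases the cut shows only as the summand i*pi for negative r,
  and base 0 has power 0, so a case distinction covers every sign.\<close>

lemma borel_measurable_of_real_powr [measurable]:
  fixes z :: complex
  assumes [measurable]: "h \<in> borel_measurable M"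
  shows "(\<lambda>x. complex_of_real (h x) powr z) \<in> borel_measurable M"
proof -
  have "complex_of_real r powr z =
      (if r = 0 then 0 else exp (z * (of_real (ln \<bar>r\<bar>) + (if r < 0 then \<i> * pi else 0))))" for r
    by (auto simp: powr_def Ln_of_real' mult.commute)
  then show ?thesis
    by simp
qed

lemma norm_of_real_powr: "0 < x \<Longrightarrow> norm (complex_of_real x powr z) = x powr Re z"
  by (simp add: norm_powr_real_powr)

text \<open>The Gamma integral and the change of variables are available for the completed measure,
  whereas the interchange takes place in \<open>lborel\<close>. For Borel integrands both measures
  give the same integral; the next lemma is the way back.\<close>

lemma absolutely_integrable_on_imp_has_bochner_integral:
  fixes f :: "real \<Rightarrow> 'a::euclidean_space"
  assumes "f absolutely_integrable_on S" "integral S f = b"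
    and "(\<lambda>x. indicator S x *\<^sub>R f x) \<in> borel_measurable borel"
  shows "has_bochner_integral lborel (\<lambda>x. indicator S x *\<^sub>R f x) b"
  using assms set_lebesgue_integral_eq_integral(2)[OF assms(1)]
  by (simp add: has_bochner_integral_iff set_integrable_def set_lebesgue_integral_def
      integrable_completion integral_completion)

lemma has_bochner_integral_imp_absolutely_integrable_on:
  fixes f :: "real \<Rightarrow> 'a::euclidean_space"
  assumes "has_bochner_integral lborel (\<lambda>x. indicator S x *\<^sub>R f x) b"
  shows "f absolutely_integrable_on S \<and> integral S f = b"
proof -
  have m: "(\<lambda>x. indicator S x *\<^sub>R f x) \<in> borel_measurable lborel"
    using assms by (auto simp: has_bochner_integral_iff)
  have "f absolutely_integrable_on S"
    using assms m by (simp add: has_bochner_integral_iff set_integrable_def integrable_completion)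
  then show ?thesis
    using assms m set_lebesgue_integral_eq_integral(2)[of S f]
    by (simp add: has_bochner_integral_iff set_lebesgue_integral_def integral_completion)
qed

section \<open>Gamma integrals and the Beta-type tail integral\<close>

lemma has_bochner_integral_Gamma:
  fixes z :: complex
  assumes "Re z > 0"
  shows "has_bochner_integral lborel
    (\<lambda>t. indicator {0<..} t *\<^sub>R (of_real t powr (z - 1) / of_real (exp t))) (Gamma z)"
proof (rule absolutely_integrable_on_imp_has_bochner_integral)
  show "(\<lambda>t. complex_of_real t powr (z - 1) / complex_of_real (exp t)) absolutely_integrable_on {0<..}"
    by (rule absolutely_integrable_Gamma_integral'[OF assms])
  show "integral {0<..} (\<lambda>t. complex_of_real t powr (z - 1) / complex_of_real (exp t)) = Gamma z"
    by (rule integral_unique[OF Gamma_integral_complex'[OF assms]])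
qed simp

text \<open>Euler's integral at r * t. The prefactor r^(1-z) cancels the power of r that comes out
  of (r t)^(z-1); with the Jacobian 1/r this leaves r^(-z).\<close>

lemma has_bochner_integral_Gamma_scaled:
  fixes z :: complex
  assumes "Re z > 0" "r > 0"
  shows "has_bochner_integral lborel
    (\<lambda>t. indicator {0<..} t *\<^sub>R (of_real t powr (z - 1) * of_real (exp (- (r * t)))))
    (Gamma z * of_real r powr (- z))"
proof -
  have "has_bochner_integral lborel
     (\<lambda>t. of_real r powr (1 - z) *
       (indicator {0<..} (0 + r * t) *\<^sub>R (of_real (0 + r * t) powr (z - 1) / of_real (exp (0 + r * t)))))
     (of_real r powr (1 - z) * (Gamma z /\<^sub>R \<bar>r\<bar>))"
    using has_bochner_integral_Gamma[OF assms(1)] assms(2)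
    by (intro has_bochner_integral_mult_right)
       (subst (asm) lborel_has_bochner_integral_real_affine_iff[where c=r and t=0], auto)
  also have "of_real r powr (1 - z) * (Gamma z /\<^sub>R \<bar>r\<bar>) = Gamma z * of_real r powr (- z)"
    using assms(2) by (simp add: scaleR_conv_of_real powr_diff powr_minus field_simps)
  also have "(\<lambda>t. of_real r powr (1 - z) *
       (indicator {0<..} (0 + r * t) *\<^sub>R (of_real (0 + r * t) powr (z - 1) / of_real (exp (0 + r * t))))) =
     (\<lambda>t. indicator {0<..} t *\<^sub>R (of_real t powr (z - 1) * of_real (exp (- (r * t)))))"
    using assms(2)
    by (auto simp: fun_eq_iff indicator_def zero_less_mult_iff powr_times_real exp_minus field_simps
        simp flip: powr_add)
  finally show ?thesis .
qed

lemma has_bochner_integral_Gamma_shifted: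
  fixes z :: complex
  assumes "Re z > 0" "r > 0"
  shows "has_bochner_integral lborel
    (\<lambda>u. indicator {s<..} u *\<^sub>R (of_real (u - s) powr (z - 1) * of_real (exp (- (r * u)))))
    (Gamma z * of_real r powr (- z) * of_real (exp (- (r * s))))"
proof -
  have "has_bochner_integral lborel
     (\<lambda>u. (indicator {0<..} (- s + 1 * u) *\<^sub>R
       (of_real (- s + 1 * u) powr (z - 1) * of_real (exp (- (r * (- s + 1 * u)))))) * of_real (exp (- (r * s))))
     ((Gamma z * of_real r powr (- z)) /\<^sub>R \<bar>1\<bar> * of_real (exp (- (r * s))))"
    using has_bochner_integral_Gamma_scaled[OF assms]
    by (intro has_bochner_integral_mult_left)
       (subst (asm) lborel_has_bochner_integral_real_affine_iff[where c=1 and t="-s"], auto)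
  also have "(\<lambda>u. (indicator {0<..} (- s + 1 * u) *\<^sub>R
       (of_real (- s + 1 * u) powr (z - 1) * of_real (exp (- (r * (- s + 1 * u)))))) * of_real (exp (- (r * s)))) =
     (\<lambda>u. indicator {s<..} u *\<^sub>R (of_real (u - s) powr (z - 1) * of_real (exp (- (r * u)))))"
    by (auto simp: fun_eq_iff indicator_def algebra_simps simp flip: exp_add of_real_mult)
  finally show ?thesis
    by simp
qed

text \<open>In the applications \<open>h'\<close> is \<open>h\<close> with exponents replaced by
  their real parts and coefficients by their norms, so the complex formula also evaluates the
  integral of the norm.\<close>

lemma has_bochner_integral_norm:
  fixes h :: "real \<Rightarrow> complex"
  assumes "has_bochner_integral lborel h' v"
    and "\<And>x. h' x = of_real (norm (h x))"
  shows "has_bochner_integral lborel (\<lambda>x. norm (h x)) (Re v)"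
  using has_bochner_integral_bounded_linear[OF bounded_linear_Re assms(1)] by (simp add: assms(2))

lemma Gamma_neq_zero: "Re z > 0 \<Longrightarrow> Gamma z \<noteq> 0"
  by (auto simp: Gamma_eq_zero_iff elim!: nonpos_Ints_cases)

lemma of_real_powr_of_real_Re:
  "0 < x \<Longrightarrow> complex_of_real x powr of_real (Re z) = of_real (norm (complex_of_real x powr z))"
  by (simp add: norm_of_real_powr powr_of_real)

text \<open>The double integrand y^(c-1) (u-s)^(b-1) exp(-yu) gives a Gamma integral of order c - b
  when u is integrated first, and Gamma c * u^(-c) (u-s)^(b-1) when y is. It is applied with b =
  \<alpha> and c = 1 - p.\<close>

lemma has_bochner_integral_Beta_tail:
  fixes b c :: complex
  assumes b: "Re b > 0" and bc: "Re b < Re c" and s: "s > 0"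
  shows "has_bochner_integral lborel
    (\<lambda>u. indicator {s<..} u *\<^sub>R (of_real u powr (- c) * of_real (u - s) powr (b - 1)))
    (Gamma b * Gamma (c - b) / Gamma c * of_real s powr (b - c))"
proof -
  \<comment> \<open>\<open>F\<close> and \<open>i\<close> keep b and c as arguments because they are
    also evaluated at the real parts.\<close>
  define F :: "complex \<Rightarrow> complex \<Rightarrow> real \<Rightarrow> real \<Rightarrow> complex" where "F b c y u =
    indicator {0<..} y *\<^sub>R (of_real y powr (c - 1) *
      (indicator {s<..} u *\<^sub>R (of_real (u - s) powr (b - 1) * of_real (exp (- (y * u))))))" for b c y u
  define i :: "complex \<Rightarrow> complex \<Rightarrow> real \<Rightarrow> complex" where "i b c y =
    Gamma b * (indicator {0<..} y *\<^sub>R (of_real y powr (c - b - 1) * of_real (exp (- (s * y)))))" for b c y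
  have inner: "has_bochner_integral lborel (F b c y) (i b c y)" if "Re b > 0" for b c y
  proof (cases "y > 0")
    case True
    have "has_bochner_integral lborel (F b c y)
      (of_real y powr (c - 1) * (Gamma b * of_real y powr (- b) * of_real (exp (- (y * s)))))"
      using True has_bochner_integral_mult_right[OF has_bochner_integral_Gamma_shifted[OF that True, of s],
          of "of_real y powr (c - 1)"]
      by (simp add: F_def[abs_def])
    also have "of_real y powr (c - 1) * (Gamma b * of_real y powr (- b) * of_real (exp (- (y * s)))) = i b c y"
      using True by (simp add: i_def powr_diff powr_add powr_minus field_simps)
    finally show ?thesis .
  qed (simp add: F_def[abs_def] i_def has_bochner_integral_zero)
  have outer: "has_bochner_integral lborel (i b c) (Gamma b * (Gamma (c - b) * of_real s powr (- (c - b))))"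
    if "Re b < Re c" for b c
    unfolding i_def using has_bochner_integral_Gamma_scaled[of "c - b" s] that s
    by (intro has_bochner_integral_mult_right) simp
  \<comment> \<open>Absolute convergence: at the real exponents the integrand equals the norm of the
    original one.\<close>
  let ?b = "complex_of_real (Re b)" and ?c = "complex_of_real (Re c)"
  have "has_bochner_integral lborel (\<lambda>u. norm (F b c y u)) (Re (i ?b ?c y))" for y
  proof (rule has_bochner_integral_norm[OF inner])
    show "F ?b ?c y u = of_real (norm (F b c y u))" for u
      using of_real_powr_of_real_Re[of y "c - 1"] of_real_powr_of_real_Re[of "u - s" "b - 1"]
      by (simp add: F_def norm_mult indicator_def)
  qed (use b in simp)
  moreover have "integrable lborel (\<lambda>y. Re (i ?b ?c y))"
    using outer[of ?b ?c] bc by (simp add: has_bochner_integral_iff)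
  moreover have "(\<lambda>(y, u). F b c y u) \<in> borel_measurable (borel \<Otimes>\<^sub>M borel)"
    unfolding F_def by measurable
  ultimately have "has_bochner_integral lborel (\<lambda>u. \<integral>y. F b c y u \<partial>lborel)
      (Gamma b * (Gamma (c - b) * of_real s powr (- (c - b))))"
    by (intro has_bochner_integral_swap(2)[OF _ _ _ inner[OF b] outer[OF bc]])
  also have "(\<lambda>u. \<integral>y. F b c y u \<partial>lborel) =
    (\<lambda>u. Gamma c * (indicator {s<..} u *\<^sub>R (of_real u powr (- c) * of_real (u - s) powr (b - 1))))"
  proof
    fix u
    show "(\<integral>y. F b c y u \<partial>lborel) =
      Gamma c * (indicator {s<..} u *\<^sub>R (of_real u powr (- c) * of_real (u - s) powr (b - 1)))"
    proof (cases "u > s")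
      case True
      have "has_bochner_integral lborel
        (\<lambda>y. of_real (u - s) powr (b - 1) *
          (indicator {0<..} y *\<^sub>R (of_real y powr (c - 1) * of_real (exp (- (u * y))))))
        (of_real (u - s) powr (b - 1) * (Gamma c * of_real u powr (- c)))"
        using b bc s True by (intro has_bochner_integral_mult_right has_bochner_integral_Gamma_scaled) auto
      moreover have "(\<lambda>y. of_real (u - s) powr (b - 1) *
          (indicator {0<..} y *\<^sub>R (of_real y powr (c - 1) * of_real (exp (- (u * y)))))) = (\<lambda>y. F b c y u)"
        using True by (simp add: F_def fun_eq_iff mult_ac)
      ultimately show ?thesis
        using True by (simp add: has_bochner_integral_iff mult_ac)
    qed (simp add: F_def)
  qed
  \<comment> \<open>Division by Gamma c is legitimate since Re c > Re b > 0.\<close>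
  finally have "has_bochner_integral lborel
      (\<lambda>u. inverse (Gamma c) * (Gamma c * (indicator {s<..} u *\<^sub>R (of_real u powr (- c) * of_real (u - s) powr (b - 1)))))
      (inverse (Gamma c) * (Gamma b * (Gamma (c - b) * of_real s powr (- (c - b)))))"
    by (rule has_bochner_integral_mult_right)
  then show ?thesis
    using Gamma_neq_zero[of c] b bc by (simp add: field_simps)
qed

section \<open>Change of variables on the half-line and interchange of the two integrations\<close>

lemma has_bochner_integral_substitution:
  fixes k :: "real \<Rightarrow> 'a::euclidean_space"
  assumes "S \<in> sets borel"
    and "\<And>x. x \<in> S \<Longrightarrow> (g has_field_derivative g' x) (at x)"
    and "\<And>x. x \<in> S \<Longrightarrow> g' x \<ge> 0"
    and "inj_on g S"
    and "(\<lambda>x. indicator S x *\<^sub>R (g' x *\<^sub>R k (g x))) \<in> borel_measurable borel"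
    and "has_bochner_integral lborel (\<lambda>u. indicator (g ` S) u *\<^sub>R k u) v"
  shows "has_bochner_integral lborel (\<lambda>x. indicator S x *\<^sub>R (g' x *\<^sub>R k (g x))) v"
proof -
  have abs_eq: "(\<lambda>x. indicator S x *\<^sub>R (\<bar>g' x\<bar> *\<^sub>R k (g x))) = (\<lambda>x. indicator S x *\<^sub>R (g' x *\<^sub>R k (g x)))"
    using assms(3) by (auto simp: indicator_def)
  have "(\<lambda>x. \<bar>g' x\<bar> *\<^sub>R k (g x)) absolutely_integrable_on S \<and>
      integral S (\<lambda>x. \<bar>g' x\<bar> *\<^sub>R k (g x)) = v"
    \<comment> \<open>The change of variables is made for the completed measure; the assumed Borel
      measurability of the transformed integrand brings the result back to
      \<open>lborel\<close>.\<close>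
    using has_bochner_integral_imp_absolutely_integrable_on[OF assms(6)]
    by (subst has_absolute_integral_change_of_variables_real)
       (use assms(1,2,4) in \<open>auto intro: has_field_derivative_at_within\<close>)
  then have "has_bochner_integral lborel (\<lambda>x. indicator S x *\<^sub>R (\<bar>g' x\<bar> *\<^sub>R k (g x))) v"
    by (intro absolutely_integrable_on_imp_has_bochner_integral) (simp_all only: abs_eq assms(5))
  then show ?thesis
    by (simp only: abs_eq)
qed

text \<open>Serves the joint measurability of double integrands that contain a half-line with moving
  endpoint.\<close>

lemma borel_measurable_indicator_greaterThan [measurable]:
  fixes a b :: "'a \<Rightarrow> real"
  assumes [measurable]: "a \<in> borel_measurable M" "b \<in> borel_measurable M"
  shows "(\<lambda>x. indicat_real {a x<..} (b x)) \<in> borel_measurable M"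
proof -
  have "(\<lambda>x. indicat_real {a x<..} (b x)) = (\<lambda>x. if a x < b x then 1 else 0)"
    by (auto simp: indicator_def)
  then show ?thesis
    by simp
qed

text \<open>\<open>\<Psi>\<close> and \<open>D\<close> play the roles of \<psi> and its derivative.
  Continuity is asked on all of the real line so that both are Borel functions; the other conditions
  concern x > 0 and the value at 0.\<close>

locale halfline_change =
  fixes \<Psi> D :: "real \<Rightarrow> real"
  assumes cont: "continuous_on UNIV \<Psi>" and cont': "continuous_on UNIV D"
    and deriv: "\<And>x. x > 0 \<Longrightarrow> (\<Psi> has_field_derivative D x) (at x)"
    and D_pos: "\<And>x. x > 0 \<Longrightarrow> D x > 0"
    and zero: "\<Psi> 0 = 0"
    and at_top: "filterlim \<Psi> at_top at_top"
begin

lemma measurable_\<Psi> [measurable]: "\<Psi> \<in> borel_measurable borel"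
  using cont by (rule borel_measurable_continuous_onI)

lemma measurable_D [measurable]: "D \<in> borel_measurable borel"
  using cont' by (rule borel_measurable_continuous_onI)

lemma less: "\<Psi> x < \<Psi> y" if "0 \<le> x" "x < y"
proof (rule DERIV_pos_imp_increasing_open[OF that(2)])
  show "\<exists>y. (\<Psi> has_field_derivative y) (at z) \<and> 0 < y" if "x < z" for z
    using deriv[of z] D_pos[of z] that \<open>0 \<le> x\<close> by auto
  show "continuous_on {x..y} \<Psi>"
    by (rule continuous_on_subset[OF cont]) simp
qed

lemma pos: "x > 0 \<Longrightarrow> \<Psi> x > 0"
  using less[of 0 x] zero by simp

lemma image_greaterThan: "\<Psi> ` {t<..} = {\<Psi> t<..}" if "t \<ge> 0"
proof (intro equalityI subsetI)
  fix u assume u: "u \<in> {\<Psi> t<..}"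
  \<comment> \<open>Divergence gives a point y beyond t with \<open>\<Psi> y \<ge> u\<close>. The
    intermediate value theorem on [t,y] then yields a preimage, which differs from t because u >
    \<open>\<Psi> t\<close>.\<close>
  obtain y where y: "\<Psi> y \<ge> u" "y \<ge> t"
    using eventually_happens'[OF _ eventually_conj[OF filterlim_at_top[THEN iffD1, OF at_top, rule_format, of u]
      eventually_ge_at_top[of t]]] by auto
  obtain x where "t \<le> x" "x \<le> y" "\<Psi> x = u"
    using IVT'[of \<Psi> t u y] u y continuous_on_subset[OF cont] by auto
  with u show "u \<in> \<Psi> ` {t<..}"
    by (cases "x = t") auto
qed (use that less in auto)

text \<open>The tail integral from s = \<open>\<Psi> t\<close>, pulled back along u =
  \<open>\<Psi> x\<close>; \<open>D x\<close> is the Jacobian.\<close>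

lemma has_bochner_integral_kernel:
  assumes "Re b > 0" "Re b < Re c" "t > 0"
  shows "has_bochner_integral lborel
    (\<lambda>x. indicator {t<..} x *\<^sub>R (D x *\<^sub>R (of_real (\<Psi> x) powr (- c) * of_real (\<Psi> x - \<Psi> t) powr (b - 1))))
    (Gamma b * Gamma (c - b) / Gamma c * of_real (\<Psi> t) powr (b - c))"
proof (rule has_bochner_integral_substitution)
  show "inj_on \<Psi> {t<..}"
  proof (rule linorder_inj_onI)
    show "\<Psi> x \<noteq> \<Psi> y" if "x < y" "x \<in> {t<..}" for x y
      using less[of x y] that assms(3) by simp
  qed auto
  show "has_bochner_integral lborel
      (\<lambda>u. indicat_real (\<Psi> ` {t<..}) u *\<^sub>R (of_real u powr (- c) * of_real (u - \<Psi> t) powr (b - 1)))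
      (Gamma b * Gamma (c - b) / Gamma c * of_real (\<Psi> t) powr (b - c))"
    using has_bochner_integral_Beta_tail[OF assms(1,2) pos[OF assms(3)]] assms(3)
    by (simp add: image_greaterThan)
  show "\<And>x. x \<in> {t<..} \<Longrightarrow> (\<Psi> has_field_derivative D x) (at x)" "\<And>x. x \<in> {t<..} \<Longrightarrow> 0 \<le> D x"
    using assms(3) deriv D_pos by (auto intro: less_imp_le)
qed measurable

text \<open>The interchange itself. Here \<open>g\<close> stands for \<omega> f \<psi>' and
  \<open>m\<close> for the Mellin transform of f at p + \<alpha>, since b - c = p + \<alpha> - 1.
  The indicators in \<open>F\<close> encode the region 0 < t < x.\<close>

lemma
  fixes b c :: complex and g :: "real \<Rightarrow> complex"
  assumes b: "Re b > 0" and bc: "Re b < Re c" and [measurable]: "g \<in> borel_measurable borel"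
    and g: "has_bochner_integral lborel (\<lambda>t. indicator {0<..} t *\<^sub>R (of_real (\<Psi> t) powr (b - c) * g t)) m"
  defines "F \<equiv> (\<lambda>t x. indicator {0<..} t *\<^sub>R (g t * (indicator {t<..} x *\<^sub>R
      (D x *\<^sub>R (of_real (\<Psi> x) powr (- c) * of_real (\<Psi> x - \<Psi> t) powr (b - 1))))))"
  shows AE_integrable_kernel: "AE x in lborel. integrable lborel (\<lambda>t. F t x)"
    and has_bochner_integral_kernel_integral: "has_bochner_integral lborel (\<lambda>x. \<integral>t. F t x \<partial>lborel)
      (Gamma b * Gamma (c - b) / Gamma c * m)"
proof -
  \<comment> \<open>The constant is a function of b and c since the integral of the norm involves it
    at their real parts.\<close>
  define B where "B b c = Gamma b * Gamma (c - b) / Gamma c" for b c :: complex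
  let ?b = "complex_of_real (Re b)" and ?c = "complex_of_real (Re c)"
  have inner: "has_bochner_integral lborel (F t) (B b c *
      (indicator {0<..} t *\<^sub>R (of_real (\<Psi> t) powr (b - c) * g t)))" for t
  proof (cases "t > 0")
    case True
    have "has_bochner_integral lborel (F t) (g t * (B b c * of_real (\<Psi> t) powr (b - c)))"
      using True has_bochner_integral_mult_right[OF has_bochner_integral_kernel[OF b bc True], of "g t"]
      by (simp add: F_def B_def)
    with True show ?thesis
      by (simp add: mult_ac)
  qed (simp add: F_def has_bochner_integral_zero)
  have norm: "has_bochner_integral lborel (\<lambda>x. norm (F t x)) (Re (B ?b ?c *
      of_real (norm (indicator {0<..} t *\<^sub>R (of_real (\<Psi> t) powr (b - c) * g t)))))" for t
  proof (cases "t > 0")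
    case True
    have "has_bochner_integral lborel (\<lambda>x. norm (F t x))
      (Re (of_real (norm (g t)) * (B ?b ?c * of_real (\<Psi> t) powr (?b - ?c))))"
    proof (rule has_bochner_integral_norm)
      show "has_bochner_integral lborel
        (\<lambda>x. of_real (norm (g t)) * (indicator {t<..} x *\<^sub>R
          (D x *\<^sub>R (of_real (\<Psi> x) powr (- ?c) * of_real (\<Psi> x - \<Psi> t) powr (?b - 1)))))
        (of_real (norm (g t)) * (B ?b ?c * of_real (\<Psi> t) powr (?b - ?c)))"
        unfolding B_def using b bc True by (intro has_bochner_integral_mult_right has_bochner_integral_kernel) auto
      show "of_real (norm (g t)) * (indicator {t<..} x *\<^sub>R
          (D x *\<^sub>R (of_real (\<Psi> x) powr (- ?c) * of_real (\<Psi> x - \<Psi> t) powr (?b - 1)))) =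
          of_real (norm (F t x))" for x
        using True pos[of x] less[of t x] D_pos[of x]
          of_real_powr_of_real_Re[of "\<Psi> x" "- c"] of_real_powr_of_real_Re[of "\<Psi> x - \<Psi> t" "b - 1"]
        by (cases "t < x") (simp_all add: F_def norm_mult scaleR_conv_of_real abs_of_pos mult_ac)
    qed
    also have "of_real (norm (g t)) * (B ?b ?c * of_real (\<Psi> t) powr (?b - ?c)) =
      B ?b ?c * of_real (norm (indicator {0<..} t *\<^sub>R (of_real (\<Psi> t) powr (b - c) * g t)))"
      using True of_real_powr_of_real_Re[OF pos[OF True], of "b - c"] by (simp add: norm_mult mult_ac)
    finally show ?thesis .
  qed (simp add: F_def has_bochner_integral_zero)
  have outer_norm: "integrable lborel (\<lambda>t. Re (B ?b ?c *
      of_real (norm (indicator {0<..} t *\<^sub>R (of_real (\<Psi> t) powr (b - c) * g t)))))"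
    using g by (intro integrable_Re integrable_mult_right integrable_of_real integrable_norm)
      (simp add: has_bochner_integral_iff)
  have meas: "(\<lambda>(t, x). F t x) \<in> borel_measurable (borel \<Otimes>\<^sub>M borel)"
    unfolding F_def by measurable
  note swap = has_bochner_integral_swap[OF meas norm outer_norm inner has_bochner_integral_mult_right[OF g]]
  show "AE x in lborel. integrable lborel (\<lambda>t. F t x)"
    by (rule swap(1))
  show "has_bochner_integral lborel (\<lambda>x. \<integral>t. F t x \<partial>lborel) (Gamma b * Gamma (c - b) / Gamma c * m)"
    using swap(2) unfolding B_def .
qed

end

section \<open>Replacing Lebesgue measurable functions by Borel ones\<close>

lemma completion_ex_borel_measurable_complex:
  fixes h :: "'a \<Rightarrow> complex"
  assumes [measurable]: "h \<in> borel_measurable (completion M)"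
  obtains g where "g \<in> borel_measurable M" "AE x in M. h x = g x"
proof -
  obtain g1 g2 where g: "g1 \<in> borel_measurable M" "AE x in M. Re (h x) = g1 x"
    "g2 \<in> borel_measurable M" "AE x in M. Im (h x) = g2 x"
    using completion_ex_borel_measurable_real[of "\<lambda>x. Re (h x)" M]
      completion_ex_borel_measurable_real[of "\<lambda>x. Im (h x)" M] by auto
  show thesis
  proof
    show "(\<lambda>x. Complex (g1 x) (g2 x)) \<in> borel_measurable M"
      using g(1,3) by (simp add: borel_measurable_complex_iff)
    show "AE x in M. h x = Complex (g1 x) (g2 x)"
      using g(2,4) by eventually_elim (simp add: complex_eq_iff)
  qed
qed

lemma integrable_mult_cancel:
  fixes c :: complex
  assumes "c \<noteq> 0" "integrable M (\<lambda>x. c * h x)"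
  shows "integrable M h"
proof -
  have "integrable M (\<lambda>x. inverse c * (c * h x))"
    using assms(2) by (rule integrable_mult_right)
  moreover have "(\<lambda>x. inverse c * (c * h x)) = h"
    using assms(1) by (simp add: fun_eq_iff)
  ultimately show ?thesis
    by simp
qed

text \<open>By completeness, agreement almost everywhere with a Borel function already makes
  \<open>a\<close> measurable. The Mellin and fractional integrands are thus handled through their
  Borel versions.\<close>

lemma lebesgue_AE_eq_borel:
  fixes a b :: "real \<Rightarrow> complex"
  assumes b: "b \<in> borel_measurable borel" and ae: "AE t in lebesgue. a t = b t"
  shows "integrable lebesgue a \<longleftrightarrow> integrable lborel b"
    and "integral\<^sup>L lebesgue a = integral\<^sup>L lborel b"
proof -
  have mb: "b \<in> borel_measurable lebesgue"
    using b by (simp add: measurable_completion)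
  have ma: "a \<in> borel_measurable lebesgue"
    by (rule borel_measurable_AE[OF mb]) (use ae in \<open>auto simp: eq_commute\<close>)
  show "integrable lebesgue a \<longleftrightarrow> integrable lborel b"
    using integrable_cong_AE[OF ma mb ae] b by (simp add: integrable_completion)
  show "integral\<^sup>L lebesgue a = integral\<^sup>L lborel b"
    using integral_cong_AE[OF ma mb ae] b by (simp add: integral_completion)
qed

text \<open>The values of \<open>\<psi>\<close> at negative arguments are arbitrary, so \<open>\<psi>\<close> itself need not be
  Borel measurable; its constant extension to the left is.\<close>

lemma halfline_change_extension:
  assumes C1: "C1_halfline \<psi>" and pos: "\<And>x. x \<ge> 0 \<Longrightarrow> hderiv \<psi> x > 0"
    and zero: "\<psi> 0 = 0" and top: "filterlim \<psi> at_top at_top"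
  shows "halfline_change (\<lambda>x. \<psi> (max 0 x)) (\<lambda>x. hderiv \<psi> (max 0 x))"
proof
  have "continuous_on {0..} \<psi>"
    using C1 by (simp add: C1_halfline_def differentiable_imp_continuous_on)
  then show "continuous_on UNIV (\<lambda>x. \<psi> (max 0 x))"
    by (rule continuous_on_compose2) (auto intro!: continuous_intros)
  have "continuous_on {0..} (hderiv \<psi>)"
    using C1 by (simp add: C1_halfline_def)
  then show "continuous_on UNIV (\<lambda>x. hderiv \<psi> (max 0 x))"
    by (rule continuous_on_compose2) (auto intro!: continuous_intros)
  show "((\<lambda>x. \<psi> (max 0 x)) has_real_derivative hderiv \<psi> (max 0 x)) (at x)" if "x > 0" for x
  proof -
    have "\<psi> differentiable (at x within {0..})"
      using C1 that by (simp add: C1_halfline_def differentiable_on_def)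
    then have "(\<psi> has_vector_derivative hderiv \<psi> x) (at x within {0..})"
      by (simp add: hderiv_def vector_derivative_works)
    moreover have "at x within {0..} = at x"
      using that by (intro at_within_interior) simp
    ultimately have "(\<psi> has_real_derivative hderiv \<psi> (max 0 x)) (at x)"
      using that by (simp add: has_real_derivative_iff_has_vector_derivative)
    then show ?thesis
      by (rule has_field_derivative_transform_within_open[of _ _ _ "{0<..}"]) (use that in auto)
  qed
  show "filterlim (\<lambda>x. \<psi> (max 0 x)) at_top at_top"
    using top by (rule filterlim_mono_eventually)
      (auto intro: eventually_mono[OF eventually_ge_at_top[of 0]])
qed (use pos zero in auto)

section \<open>The Mellin transform of the fractional integral\<close>

theorem mainTheorem4:
  fixes \<psi> :: "real \<Rightarrow> real" and \<omega> f :: "real \<Rightarrow> complex" and \<alpha> p :: complex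
  assumes psi_C1: "C1_halfline \<psi>"
    and psi_deriv_pos: "\<And>x. x \<ge> 0 \<Longrightarrow> hderiv \<psi> x > 0"
    and psi_zero: "\<psi> 0 = 0"
    and psi_at_top: "filterlim \<psi> at_top at_top"
    and omega_Linfty: "\<omega> \<in> Linfty_pos"
    and omega_nonzero: "\<And>x. x > 0 \<Longrightarrow> \<omega> x \<noteq> 0"
    and alpha: "Re \<alpha> > 0"
    and p: "Re p < 1 - Re \<alpha>"
    and f: "(\<lambda>x. of_real (\<psi> x) powr (p + \<alpha> - 1) * f x) \<in> L1_weighted \<omega> \<psi>"
  shows "(AE x in lebesgue_on {0<..}. RL_converges \<psi> \<omega> \<alpha> f x) \<and>
    mellin_converges \<psi> \<omega> (RL_integral \<psi> \<omega> \<alpha> f) p \<and>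
    mellin_converges \<psi> \<omega> f (p + \<alpha>) \<and>
    mellin \<psi> \<omega> (RL_integral \<psi> \<omega> \<alpha> f) p =
      Gamma (1 - p - \<alpha>) / Gamma (1 - p) * mellin \<psi> \<omega> f (p + \<alpha>)"
proof -
  define \<Psi> where "\<Psi> x = \<psi> (max 0 x)" for x
  define D where "D x = hderiv \<psi> (max 0 x)" for x
  interpret halfline_change \<Psi> D
    unfolding \<Psi>_def D_def using psi_C1 psi_deriv_pos psi_zero psi_at_top by (rule halfline_change_extension)
  have [simp]: "\<psi> x = \<Psi> x" "hderiv \<psi> x = D x" if "x > 0" for x
    using that by (simp_all add: \<Psi>_def D_def)
  \<comment> \<open>Extension by zero turns measurability on \<open>lebesgue_on {0<..}\<close> into
    measurability on the whole line.\<close>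
  define w where "w x = indicator {0<..} x *\<^sub>R \<omega> x" for x
  define k where "k x = indicator {0<..} x *\<^sub>R (of_real (\<psi> x) powr (p + \<alpha> - 1) * f x)" for x
  have [simp]: "w \<in> borel_measurable lebesgue" "k \<in> borel_measurable lebesgue"
    using omega_Linfty f unfolding w_def k_def Linfty_pos_def L1_weighted_def
    by (simp_all add: borel_measurable_restrict_space_iff)
  have [simp]: "\<Psi> \<in> borel_measurable lebesgue" "D \<in> borel_measurable lebesgue"
    by (simp_all add: measurable_completion)
  \<comment> \<open>Measurability is given for \<psi>^(p+\<alpha>-1) f rather than for f, so the
    power is undone by its reciprocal; on x > 0 this makes \<open>h\<close> equal to \<omega> f
    \<psi>'.\<close>
  define h where "h x = w x * k x * of_real (D x) * of_real (\<Psi> x) powr (1 - p - \<alpha>)" for x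
  have h: "h x = \<omega> x * f x * of_real (hderiv \<psi> x)" if "x > 0" for x
    using that pos[OF that] by (simp add: h_def w_def k_def powr_diff powr_add field_simps)
  have "h \<in> borel_measurable lebesgue"
    unfolding h_def by (intro borel_measurable_times borel_measurable_of_real_powr
        measurable_compose[OF _ borel_measurable_of_real]) simp_all
  \<comment> \<open>Fubini needs measurability for the product of Borel algebras, and \<open>h\<close> is only Lebesgue measurable.\<close>
  then obtain g where g [measurable]: "g \<in> borel_measurable borel" and hg: "AE t in lebesgue. h t = g t"
    by (rule completion_ex_borel_measurable_complex) (auto dest: AE_completion)
  \<comment> \<open>A Borel version of the Mellin integrand of f at p + \<alpha>; its integrability
    is exactly the weighted L1 hypothesis.\<close>
  define \<phi> where "\<phi> t = indicator {0<..} t *\<^sub>R (of_real (\<Psi> t) powr (p + \<alpha> - 1) * g t)" for t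
  have mellin_f: "AE t in lebesgue. indicator {0<..} t *\<^sub>R mellin_integrand \<psi> \<omega> f (p + \<alpha>) t = \<phi> t"
    using hg by eventually_elim (auto simp: \<phi>_def mellin_integrand_def indicator_def h mult_ac)
  have \<phi>_meas [measurable]: "\<phi> \<in> borel_measurable borel"
    unfolding \<phi>_def by measurable
  have "(\<integral>\<^sup>+t. norm (\<phi> t) \<partial>lborel) = (\<integral>\<^sup>+t. norm (\<phi> t) \<partial>lebesgue)"
    by (rule nn_integral_completion[symmetric])
  also have "\<dots> = (\<integral>\<^sup>+x\<in>{0<..}. ennreal (norm (\<omega> x * (of_real (\<psi> x) powr (p + \<alpha> - 1) * f x)) * hderiv \<psi> x) \<partial>lebesgue)"
  proof (rule nn_integral_cong_AE, use hg in eventually_elim)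
    fix x assume hg: "h x = g x"
    have "norm (\<phi> x) = norm (\<omega> x * (of_real (\<psi> x) powr (p + \<alpha> - 1) * f x)) * hderiv \<psi> x" if "x > 0"
      using that D_pos[OF that] by (simp add: \<phi>_def norm_mult mult_ac abs_of_pos h flip: hg)
    then show "ennreal (norm (\<phi> x)) =
        ennreal (norm (\<omega> x * (of_real (\<psi> x) powr (p + \<alpha> - 1) * f x)) * hderiv \<psi> x) * indicator {0<..} x"
      by (cases "x > 0") (simp_all add: \<phi>_def)
  qed
  also have "\<dots> < \<infinity>"
    using f by (simp add: L1_weighted_def)
  finally have \<phi>: "integrable lborel \<phi>"
    by (simp add: integrable_iff_bounded)
  define m where "m = integral\<^sup>L lborel \<phi>"
  \<comment> \<open>The double integrand of the interchange with b = \<alpha> and c = 1 - p; the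
    condition Re b < Re c is the hypothesis on p.\<close>
  let ?F = "\<lambda>t x. indicator {0<..} t *\<^sub>R (g t * (indicator {t<..} x *\<^sub>R
      (D x *\<^sub>R (of_real (\<Psi> x) powr (- (1 - p)) * of_real (\<Psi> x - \<Psi> t) powr (\<alpha> - 1)))))"
  have "has_bochner_integral lborel
      (\<lambda>t. indicator {0<..} t *\<^sub>R (of_real (\<Psi> t) powr (\<alpha> - (1 - p)) * g t)) m"
    using \<phi> by (simp add: has_bochner_integral_iff m_def \<phi>_def[abs_def] algebra_simps)
  note kernel = AE_integrable_kernel[OF alpha _ g this] has_bochner_integral_kernel_integral[OF alpha _ g this]
  \<comment> \<open>For fixed x the two indicators in \<open>?F\<close> combine to that of
    \<open>{0<..<x}\<close>, and the factors depending on x alone come out in front.\<close>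
  have RL: "AE t in lebesgue. of_real (\<Psi> x) powr (p - 1) * of_real (D x) *
      (indicator {0<..<x} t *\<^sub>R RL_integrand \<psi> \<omega> \<alpha> f x t) = ?F t x" if "x > 0" for x
    using hg
  proof eventually_elim
    fix t assume hg: "h t = g t"
    show "of_real (\<Psi> x) powr (p - 1) * of_real (D x) *
      (indicator {0<..<x} t *\<^sub>R RL_integrand \<psi> \<omega> \<alpha> f x t) = ?F t x"
      using that by (auto simp: RL_integrand_def indicator_def scaleR_conv_of_real mult_ac h simp flip: hg)
  qed
  have F_meas: "(\<lambda>t. ?F t x) \<in> borel_measurable borel" for x
    by measurable
  \<comment> \<open>The factor in front is nonzero, so integrability of \<open>?F\<close> in t
    passes to the fractional integrand.\<close>
  have q: "of_real (\<Psi> x) powr (p - 1) * complex_of_real (D x) \<noteq> 0" if "x > 0" for x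
    using pos[OF that] D_pos[OF that] by simp
  have RL_converges: "RL_converges \<psi> \<omega> \<alpha> f x" if "integrable lborel (\<lambda>t. ?F t x)" "x > 0" for x
  proof -
    have "integrable lebesgue (\<lambda>t. of_real (\<Psi> x) powr (p - 1) * of_real (D x) *
        (indicator {0<..<x} t *\<^sub>R RL_integrand \<psi> \<omega> \<alpha> f x t))"
      using lebesgue_AE_eq_borel(1)[OF F_meas RL[OF that(2)]] that(1) by blast
    then show ?thesis
      unfolding RL_converges_def set_integrable_def by (rule integrable_mult_cancel[OF q[OF that(2)]])
  qed
  \<comment> \<open>The outer weight \<open>\<omega> x\<close> cancels the one in the denominator.
    The identity holds for every x: where the fractional integral diverges, the integrals on both
    sides take the default value 0.\<close>
  have RL_integral: "indicator {0<..} x *\<^sub>R mellin_integrand \<psi> \<omega> (RL_integral \<psi> \<omega> \<alpha> f) p x =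
      1 / Gamma \<alpha> * (\<integral>t. ?F t x \<partial>lborel)" for x
  proof (cases "x > 0")
    case True
    have "indicator {0<..} x *\<^sub>R mellin_integrand \<psi> \<omega> (RL_integral \<psi> \<omega> \<alpha> f) p x =
        1 / Gamma \<alpha> * (of_real (\<Psi> x) powr (p - 1) * of_real (D x) *
          (LINT t:{0<..<x}|lebesgue. RL_integrand \<psi> \<omega> \<alpha> f x t))"
      using True omega_nonzero[OF True] by (simp add: mellin_integrand_def RL_integral_def)
    also have "of_real (\<Psi> x) powr (p - 1) * of_real (D x) * (LINT t:{0<..<x}|lebesgue. RL_integrand \<psi> \<omega> \<alpha> f x t) =
        (\<integral>t. ?F t x \<partial>lborel)"
      using lebesgue_AE_eq_borel(2)[OF F_meas RL[OF True]]
      unfolding set_lebesgue_integral_def integral_mult_right_zero .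
    finally show ?thesis .
  next
    case False
    then have F_zero: "(\<lambda>t. ?F t x) = (\<lambda>t. 0)"
      by (auto simp: fun_eq_iff indicator_def)
    show ?thesis
      unfolding F_zero using False by simp
  qed
  have mellin_RL: "has_bochner_integral lborel (\<lambda>x. indicator {0<..} x *\<^sub>R mellin_integrand \<psi> \<omega> (RL_integral \<psi> \<omega> \<alpha> f) p x)
      (1 / Gamma \<alpha> * (Gamma \<alpha> * Gamma (1 - p - \<alpha>) / Gamma (1 - p) * m))"
    unfolding RL_integral using kernel(2) p by (intro has_bochner_integral_mult_right) simp
  show ?thesis
  proof (intro conjI)
    have "AE x in lebesgue. integrable lborel (\<lambda>t. ?F t x)"
      using kernel(1) p by (intro AE_completion) simp
    then have "AE x in lebesgue. x \<in> {0<..} \<longrightarrow> RL_converges \<psi> \<omega> \<alpha> f x"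
      by eventually_elim (use RL_converges in blast)
    then show "AE x in lebesgue_on {0<..}. RL_converges \<psi> \<omega> \<alpha> f x"
      by (subst AE_restrict_space_iff) simp_all
    show "mellin_converges \<psi> \<omega> (RL_integral \<psi> \<omega> \<alpha> f) p"
      using mellin_RL by (auto simp: mellin_converges_def set_integrable_def has_bochner_integral_iff integrable_completion)
    show "mellin_converges \<psi> \<omega> f (p + \<alpha>)"
      using lebesgue_AE_eq_borel(1)[OF \<phi>_meas mellin_f] \<phi> by (simp add: mellin_converges_def set_integrable_def)
    have "mellin \<psi> \<omega> f (p + \<alpha>) = m"
      using lebesgue_AE_eq_borel(2)[OF \<phi>_meas mellin_f] by (simp add: mellin_def set_lebesgue_integral_def m_def)
    moreover have "mellin \<psi> \<omega> (RL_integral \<psi> \<omega> \<alpha> f) p =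
        1 / Gamma \<alpha> * (Gamma \<alpha> * Gamma (1 - p - \<alpha>) / Gamma (1 - p) * m)"
      using mellin_RL by (auto simp: mellin_def set_lebesgue_integral_def has_bochner_integral_iff integral_completion)
    ultimately show "mellin \<psi> \<omega> (RL_integral \<psi> \<omega> \<alpha> f) p =
        Gamma (1 - p - \<alpha>) / Gamma (1 - p) * mellin \<psi> \<omega> f (p + \<alpha>)"
      using Gamma_neq_zero[OF alpha] by simp
  qed
qed

end
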